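(* Let $\lambda\in\mathbb{R}\setminus\{0\}$, let $r$ be a nonnegative integer, and let $n,m\ge 0$ be integers. Then $$\frac{1}{m!}\bigg(\frac{d}{dx}\bigg)^{m}\Big(x^{m}F_{n,\lambda}(x|r)\Big)=\sum_{k=0}^{n}{n+r \brace k+r}_{r,\lambda}k!\binom{k+m}{k}x^{k}.$$
   Context: For $\lambda\neq0$, $(x)_{0,\lambda}=1$ and $(x)_{n,\lambda}=x(x-\lambda)\cdots(x-(n-1)\lambda)$ for $n\ge1$; $(x)_k=x(x-1)\cdots(x-k+1)$; $e_{\lambda}^{x}(t)=(1+\lambda t)^{x/\lambda}$, $e_\lambda(t)=e_\lambda^1(t)$. The degenerate $r$-Stirling numbers of the second kind are defined by $(x+r)_{n,\lambda}=\sum_{k=0}^{n}{n+r \brace k+r}_{r,\lambda}(x)_{k}$ ($n\ge0$). The two variable degenerate Fubini polynomials $F_{n,\lambda}(x|r)$ are defined by $\frac{1}{1-x(e_{\lambda}(t)-1)}e_{\lambda}^{r}(t)=\sum_{n=0}^{\infty}F_{n,\lambda}(x|r)\frac{t^{n}}{n!}$. *)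

theory Defs
  imports "HOL-Analysis.Analysis"
begin

definition deg_falling :: "real \<Rightarrow> real \<Rightarrow> nat \<Rightarrow> real" where
  "deg_falling lam x n = (\<Prod>i<n. x - real i * lam)"

definition falling :: "real \<Rightarrow> nat \<Rightarrow> real" where
  "falling x k = (\<Prod>i<k. x - real i)"

text \<open>
  \<open>deg_exp lam x\<close> is the formal power series \<open>(1 + lam t)^(x/lam)\<close> in \<open>t\<close>, obtained by
  substituting \<open>lam t\<close> into the binomial series \<open>(1 + t)^(x/lam)\<close>.
\<close>

definition deg_exp :: "real \<Rightarrow> real \<Rightarrow> real fps" where
  "deg_exp lam x = fps_binomial (x / lam) oo (fps_const lam * fps_X)"

text \<open>
  \<open>deg_r_stirling2 lam r n k\<close> is the number usually displayed with upper entry \<open>n + r\<close> and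
  lower entry \<open>k + r\<close>: the arguments are the unshifted \<open>n\<close> and \<open>k\<close>.
  The defining expansion determines it for \<open>k \<le> n\<close> (see \<open>deg_r_stirling2_ex1\<close>); for \<open>k > n\<close> it
  is set to 0.
\<close>

definition deg_r_stirling2 :: "real \<Rightarrow> nat \<Rightarrow> nat \<Rightarrow> nat \<Rightarrow> real" where
  "deg_r_stirling2 lam r n =
    (THE S. (\<forall>x. deg_falling lam (x + real r) n = (\<Sum>k\<le>n. S k * falling x k)) \<and>
            (\<forall>k>n. S k = 0))"

text \<open>
  The generating function is read as a formal power series in \<open>t\<close>, for each fixed real \<open>x\<close>; its
  denominator has constant coefficient 1.
\<close>

definition deg_fubini :: "real \<Rightarrow> nat \<Rightarrow> nat \<Rightarrow> real \<Rightarrow> real" where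
  "deg_fubini lam r n x =
    fact n * fps_nth (inverse (1 - fps_const x * (deg_exp lam 1 - 1)) * deg_exp lam (real r)) n"

lemma deg_exp_nth:
  assumes "lam \<noteq> 0"
  shows "fps_nth (deg_exp lam x) n = deg_falling lam x n / fact n"
proof -
  have "fps_nth (deg_exp lam x) n = lam ^ n * ((x / lam) gchoose n)"
    by (simp add: deg_exp_def fps_compose_linear)
  also have "\<dots> = (\<Prod>i<n. lam * (x / lam - real i)) / fact n"
    by (simp add: gbinomial_prod_rev atLeast0LessThan prod.distrib)
  also have "\<dots> = deg_falling lam x n / fact n"
    using assms by (simp add: deg_falling_def algebra_simps)
  finally show ?thesis .
qed

lemma deg_fubini_generating_function:
  "Abs_fps (\<lambda>n. deg_fubini lam r n x / fact n) * (1 - fps_const x * (deg_exp lam 1 - 1)) =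
    deg_exp lam (real r)"
proof -
  let ?D = "1 - fps_const x * (deg_exp lam 1 - 1)"
  have "fps_nth ?D 0 = 1"
    by (simp add: deg_exp_def fps_compose_linear)
  then have "fps_nth ?D 0 \<noteq> 0"
    by (simp only: one_neq_zero not_False_eq_True)
  then have "inverse ?D * ?D = 1"
    by (rule inverse_mult_eq_1)
  then have "a = inverse ?D * b \<Longrightarrow> a * ?D = b" for a b
    by (simp only: mult.commute[of _ b] mult.assoc mult_1_right)
  moreover have "Abs_fps (\<lambda>n. deg_fubini lam r n x / fact n) = inverse ?D * deg_exp lam (real r)"
    by (rule fps_ext) (simp add: deg_fubini_def)
  ultimately show ?thesis
    by blast
qed

lemma falling_of_nat_eq_0: "j < k \<Longrightarrow> falling (real j) k = 0"
  by (auto simp: falling_def)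

lemma falling_of_nat_self: "falling (real j) j \<noteq> 0"
  by (auto simp: falling_def)

lemma falling_Suc: "falling x (Suc k) = falling x k * (x - real k)"
  by (simp add: falling_def)

lemma falling_expansion_unique:
  assumes eq: "\<And>x. (\<Sum>k\<le>n. S k * falling x k) = (\<Sum>k\<le>n. T k * falling x k)"
    and "j \<le> n"
  shows "S j = T j"
  using \<open>j \<le> n\<close>
proof (induction j rule: less_induct)
  case (less j)
  have tail: "(\<Sum>k\<le>n. U k * falling (real j) k) =
      (\<Sum>k<j. U k * falling (real j) k) + U j * falling (real j) j" for U
  proof -
    have "(\<Sum>k\<le>n. U k * falling (real j) k) = (\<Sum>k\<le>j. U k * falling (real j) k)"
      using less.prems by (intro sum.mono_neutral_right) (auto simp: falling_of_nat_eq_0)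
    then show ?thesis
      by (simp flip: lessThan_Suc_atMost)
  qed
  have "(\<Sum>k<j. S k * falling (real j) k) = (\<Sum>k<j. T k * falling (real j) k)"
    using less by (intro sum.cong) auto
  with eq[of "real j"] show ?case
    unfolding tail by (simp add: falling_of_nat_self)
qed

lemma deg_falling_expansion_exists:
  "\<exists>S. (\<forall>x. deg_falling lam (x + real r) n = (\<Sum>k\<le>n. S k * falling x k)) \<and> (\<forall>k>n. S k = 0)"
proof (induction n)
  case 0
  show ?case
    by (rule exI[of _ "\<lambda>k. if k = 0 then 1 else 0"]) (simp add: deg_falling_def falling_def)
next
  case (Suc n)
  then obtain S where S: "\<And>x. deg_falling lam (x + real r) n = (\<Sum>k\<le>n. S k * falling x k)"
    and S0: "\<And>k. k > n \<Longrightarrow> S k = 0" by blast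
  define T where "T k = (if k = 0 then 0 else S (k - 1)) + (real k + real r - real n * lam) * S k" for k
  have "deg_falling lam (x + real r) (Suc n) = (\<Sum>k\<le>Suc n. T k * falling x k)" for x
  proof -
    have "deg_falling lam (x + real r) (Suc n) =
        (\<Sum>k\<le>n. S k * falling x k) * (x + real r - real n * lam)"
      by (simp add: S[symmetric] deg_falling_def)
    also have "\<dots> = (\<Sum>k\<le>n. S k * falling x (Suc k)) +
        (\<Sum>k\<le>n. (real k + real r - real n * lam) * S k * falling x k)"
      unfolding sum_distrib_right sum.distrib[symmetric]
      by (intro sum.cong) (simp_all add: falling_Suc algebra_simps)
    also have "(\<Sum>k\<le>n. S k * falling x (Suc k)) =
        (\<Sum>k\<le>Suc n. (if k = 0 then 0 else S (k - 1)) * falling x k)"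
      by (simp add: sum.atMost_Suc_shift del: sum.atMost_Suc)
    also have "(\<Sum>k\<le>n. (real k + real r - real n * lam) * S k * falling x k) =
        (\<Sum>k\<le>Suc n. (real k + real r - real n * lam) * S k * falling x k)"
      by (simp add: S0)
    finally show ?thesis
      by (simp only: T_def distrib_right sum.distrib)
  qed
  moreover have "\<forall>k>Suc n. T k = 0"
    by (auto simp: T_def S0)
  ultimately show ?case by blast
qed

lemma deg_r_stirling2_ex1:
  "\<exists>!S. (\<forall>x. deg_falling lam (x + real r) n = (\<Sum>k\<le>n. S k * falling x k)) \<and> (\<forall>k>n. S k = 0)"
proof (rule ex_ex1I[OF deg_falling_expansion_exists])
  fix S T
  assume S: "(\<forall>x. deg_falling lam (x + real r) n = (\<Sum>k\<le>n. S k * falling x k)) \<and> (\<forall>k>n. S k = 0)"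
    and T: "(\<forall>x. deg_falling lam (x + real r) n = (\<Sum>k\<le>n. T k * falling x k)) \<and> (\<forall>k>n. T k = 0)"
  show "S = T"
  proof
    fix k
    show "S k = T k"
    proof (cases "k \<le> n")
      case True
      have "(\<Sum>k\<le>n. S k * falling x k) = (\<Sum>k\<le>n. T k * falling x k)" for x
        using S T by (auto dest: spec[of _ x])
      then show ?thesis
        using True by (rule falling_expansion_unique)
    next
      case False
      with S T show ?thesis by simp
    qed
  qed
qed

lemma deg_r_stirling2_expansion:
  "deg_falling lam (x + real r) n = (\<Sum>k\<le>n. deg_r_stirling2 lam r n k * falling x k)"
  using theI'[OF deg_r_stirling2_ex1[of lam r n]] unfolding deg_r_stirling2_def by blast

end

theory Submission
  imports Defs
begin

text \<open>
  Since \<open>e\<^sub>\<lambda>\<^sup>j = (1 + (e\<^sub>\<lambda> - 1))\<^sup>j\<close>, the coefficient of \<open>t\<^sup>n / n!\<close> in \<open>e\<^sub>\<lambda>\<^sup>j e\<^sub>\<lambda>\<^sup>r\<close> expands binomially in the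
  coefficients of \<open>(e\<^sub>\<lambda> - 1)\<^sup>k e\<^sub>\<lambda>\<^sup>r\<close>; it equals \<open>(j + r)\<^bsub>n,\<lambda>\<^esub>\<close>, whose expansion in binomials
  \<open>j choose k\<close> has the coefficients \<open>k!\<close> times the degenerate Stirling numbers. Comparing
  both for all natural \<open>j\<close> identifies the coefficients, the geometric series turns this into
  \<open>F\<^bsub>n,\<lambda>\<^esub>(y|r) = \<Sum>\<^sub>k S\<^sub>k k! y\<^sup>k\<close>, and the claim follows by differentiating termwise.
\<close>

text \<open>The transform is triangular with unit diagonal: once all smaller indices agree, the
  equation at \<open>j\<close> leaves only \<open>a j = b j\<close>.\<close>

lemma binomial_transform_inject:
  fixes a b :: "nat \<Rightarrow> real"
  assumes "\<And>j. (\<Sum>k\<le>j. real (j choose k) * a k) = (\<Sum>k\<le>j. real (j choose k) * b k)"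
  shows "a j = b j"
proof (induction j rule: less_induct)
  case (less j)
  then have "(\<Sum>k<j. real (j choose k) * a k) = (\<Sum>k<j. real (j choose k) * b k)"
    by (intro sum.cong) auto
  with assms[of j] show ?case
    by (simp flip: lessThan_Suc_atMost)
qed

lemma falling_of_nat: "falling (real j) k = fact k * real (j choose k)"
  by (simp add: falling_def binomial_gbinomial gbinomial_prod_rev atLeast0LessThan)

lemma deg_exp_add: "deg_exp lam (x + y) = deg_exp lam x * deg_exp lam y"
  by (simp add: deg_exp_def add_divide_distrib fps_binomial_add_mult fps_compose_mult_distrib)

lemma deg_exp_0: "deg_exp lam 0 = 1"
  by (simp add: deg_exp_def)

lemma deg_exp_of_nat: "deg_exp lam (real j) = deg_exp lam 1 ^ j"
  by (induction j) (simp_all add: deg_exp_add deg_exp_0)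

lemma deg_exp_nth_0: "fps_nth (deg_exp lam x) 0 = 1"
  by (simp add: deg_exp_def fps_compose_linear)

text \<open>\<open>E ^ k\<close> has no terms of degree below \<open>k\<close>, and a factor
  \<open>G\<close> cannot lower the order.\<close>

lemma fps_nth_power_mult_eq_0:
  fixes E G :: "'a :: comm_ring_1 fps"
  assumes "fps_nth E 0 = 0" "n < k"
  shows "fps_nth (E ^ k * G) n = 0"
  using assms by (auto simp: fps_mult_nth startsby_zero_power_prefix intro!: sum.neutral)

lemma deg_r_stirling2_eq_0: "n < k \<Longrightarrow> deg_r_stirling2 lam r n k = 0"
  using theI'[OF deg_r_stirling2_ex1[of lam r n]] unfolding deg_r_stirling2_def by blast

lemma deg_r_stirling2_generating_function:
  assumes "lam \<noteq> 0"
  shows "fact n * fps_nth ((deg_exp lam 1 - 1) ^ k * deg_exp lam (real r)) n =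
    fact k * deg_r_stirling2 lam r n k"
proof (rule binomial_transform_inject)
  fix j
  let ?E = "deg_exp lam 1 - 1" and ?R = "deg_exp lam (real r)" and ?S = "deg_r_stirling2 lam r n"
  have "deg_exp lam (real j + real r) = (?E + 1) ^ j * ?R"
    by (simp add: deg_exp_add deg_exp_of_nat)
  also have "\<dots> = (\<Sum>k\<le>j. of_nat (j choose k) * (?E ^ k * ?R))"
    by (simp only: binomial_ring sum_distrib_right mult.assoc power_one mult_1_left)
  finally have "(\<Sum>k\<le>j. real (j choose k) * (fact n * fps_nth (?E ^ k * ?R) n)) =
      fact n * fps_nth (deg_exp lam (real j + real r)) n"
    by (simp add: fps_sum_nth sum_distrib_left fps_of_nat[symmetric] mult.left_commute)
  also have "\<dots> = (\<Sum>k\<le>n. ?S k * falling (real j) k)"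
    using assms by (simp add: deg_exp_nth deg_r_stirling2_expansion)
  \<comment> \<open>The common bound \<open>n + j\<close> allows both changes of range: the Stirling
    numbers vanish for \<open>k > n\<close>, the falling factorials of \<open>j\<close> for
    \<open>k > j\<close>.\<close>
  also have "\<dots> = (\<Sum>k\<le>n + j. ?S k * falling (real j) k)"
    by (rule sum.mono_neutral_left) (auto simp: deg_r_stirling2_eq_0)
  also have "\<dots> = (\<Sum>k\<le>j. ?S k * falling (real j) k)"
    by (rule sum.mono_neutral_right) (auto simp: falling_of_nat)
  also have "\<dots> = (\<Sum>k\<le>j. real (j choose k) * (fact k * ?S k))"
    by (simp add: falling_of_nat mult_ac)
  finally show "(\<Sum>k\<le>j. real (j choose k) * (fact n * fps_nth (?E ^ k * ?R) n)) =
      (\<Sum>k\<le>j. real (j choose k) * (fact k * ?S k))" .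
qed

text \<open>A finite geometric sum suffices: the remainder carries the factor
  \<open>E ^ Suc n\<close>, which cannot reach degree \<open>n\<close>.\<close>

lemma fps_nth_geometric_mult:
  fixes E G :: "'a :: field fps"
  assumes "fps_nth E 0 = 0"
  shows "fps_nth (inverse (1 - E) * G) n = (\<Sum>k\<le>n. fps_nth (E ^ k * G) n)"
proof -
  have D: "inverse (1 - E) * (1 - E) = 1"
    using assms by (intro inverse_mult_eq_1) simp
  have "(1 - E) * (\<Sum>k\<le>n. E ^ k) = 1 - E ^ Suc n"
    by (rule sum_gp_basic)
  then have "(\<Sum>k\<le>n. E ^ k) = inverse (1 - E) * (1 - E ^ Suc n)"
    by (metis D mult.assoc mult_1)
  then have "inverse (1 - E) = (\<Sum>k\<le>n. E ^ k) + E ^ Suc n * inverse (1 - E)"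
    by (simp add: algebra_simps)
  then have "inverse (1 - E) * G = (\<Sum>k\<le>n. E ^ k * G) + E ^ Suc n * (inverse (1 - E) * G)"
    by (metis distrib_right sum_distrib_right mult.assoc)
  then have "fps_nth (inverse (1 - E) * G) n =
      fps_nth (\<Sum>k\<le>n. E ^ k * G) n + fps_nth (E ^ Suc n * (inverse (1 - E) * G)) n"
    by (metis fps_add_nth)
  with assms show ?thesis
    by (simp only: fps_nth_power_mult_eq_0 lessI fps_sum_nth add_0_right)
qed

lemma deg_fubini_eq_sum:
  assumes "lam \<noteq> 0"
  shows "deg_fubini lam r n y = (\<Sum>k\<le>n. deg_r_stirling2 lam r n k * fact k * y ^ k)"
proof -
  let ?E = "deg_exp lam 1 - 1" and ?R = "deg_exp lam (real r)"
  have "deg_fubini lam r n y = fact n * (\<Sum>k\<le>n. fps_nth ((fps_const y * ?E) ^ k * ?R) n)"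
    \<comment> \<open>The geometric expansion applies because \<open>deg_exp lam 1\<close> has
      constant term 1.\<close>
    unfolding deg_fubini_def by (subst fps_nth_geometric_mult) (simp_all add: deg_exp_nth_0)
  also have "\<dots> = (\<Sum>k\<le>n. y ^ k * (fact n * fps_nth (?E ^ k * ?R) n))"
    by (simp add: sum_distrib_left power_mult_distrib fps_const_power mult.assoc mult.left_commute)
  also have "\<dots> = (\<Sum>k\<le>n. deg_r_stirling2 lam r n k * fact k * y ^ k)"
    by (simp only: deg_r_stirling2_generating_function[OF assms]) (simp add: mult_ac)
  finally show ?thesis .
qed

lemma higher_deriv_power_mult_polynomial:
  fixes c :: "nat \<Rightarrow> real"
  shows "(deriv ^^ m) (\<lambda>y. \<Sum>k\<le>n. c k * y ^ (k + m)) =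
    (\<lambda>y. \<Sum>k\<le>n. c k * (fact (k + m) / fact k) * y ^ k)"
proof (induction m arbitrary: c)
  case 0
  show ?case by simp
next
  case (Suc m)
  have "((\<lambda>y. c k * y ^ (k + Suc m)) has_real_derivative c k * real (k + Suc m) * y ^ (k + m)) (at y)"
    for k y
    using DERIV_cmult[OF DERIV_pow[of "k + Suc m" y], of "c k"] by (simp add: mult.assoc)
  then have "deriv (\<lambda>y. \<Sum>k\<le>n. c k * y ^ (k + Suc m)) =
      (\<lambda>y. \<Sum>k\<le>n. c k * real (k + Suc m) * y ^ (k + m))"
    by (intro ext DERIV_imp_deriv DERIV_sum)
  \<comment> \<open>The innermost derivative is taken first, so the induction hypothesis is used
    with coefficients \<open>c k * real (k + Suc m)\<close>; hence \<open>c\<close> is kept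
    arbitrary.\<close>
  then show ?case
    by (simp only: funpow_Suc_right comp_apply Suc.IH) (simp add: field_simps)
qed

theorem theorem8:
  fixes lam x :: real and r n m :: nat
  assumes "lam \<noteq> 0"
  shows "1 / fact m * (deriv ^^ m) (\<lambda>y. y ^ m * deg_fubini lam r n y) x =
    (\<Sum>k=0..n. deg_r_stirling2 lam r n k * fact k * real ((k + m) choose k) * x ^ k)"
proof -
  have "(\<lambda>y. y ^ m * deg_fubini lam r n y) =
      (\<lambda>y. \<Sum>k\<le>n. deg_r_stirling2 lam r n k * fact k * y ^ (k + m))"
    using assms by (simp add: deg_fubini_eq_sum sum_distrib_left power_add mult_ac)
  \<comment> \<open>Dividing \<open>fact (k + m) / fact k\<close> by \<open>fact m\<close> gives the
    binomial coefficient.\<close>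
  then show ?thesis
    by (simp only: higher_deriv_power_mult_polynomial)
      (simp add: sum_distrib_left atLeast0AtMost binomial_fact field_simps)
qed

end
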